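(* Let $G=(V,E,w)$ be an undirected graph with real edge weights at least $1$, maximum degree $D$, and maximum edge weight $W_{\max}$ (known to the algorithm). The set of (weighted) edges returned by the algorithm LBL-R$(V)$ described below is exactly $E$.
   Context: $G[w\ge W_{\mathrm{thr}}]$ is the spanning subgraph of $G$ containing exactly the edges of weight at least $W_{\mathrm{thr}}$. Queries: $q_w(u,v,W_{\mathrm{thr}})$ returns $w(u,v)$ if $uv$ is an edge of $G[w\ge W_{\mathrm{thr}}]$ and $0$ otherwise; $q_d(u,v,W_{\mathrm{thr}})$ returns the shortest weighted path length between $u,v$ in $G[w\ge W_{\mathrm{thr}}]$ ($+\infty$ if none); $q_c(u,S,W_{\mathrm{thr}})$ returns $1$ iff some $v\in S$ is in the same connected component as $u$ in $G[w\ge W_{\mathrm{thr}}]$. Write $d$ for the distance returned by $q_d$ and $d(S,v)=\min_{s\in S}d(s,v)$. Subroutines: FIND-CONNECTED-COMPONENTS$(V,W_{\mathrm{thr}})$ computes the vertex sets of the connected components of $G[w\ge W_{\mathrm{thr}}]$ using $q_c$ queries (inserting vertices one by one and locating their component by binary search). EXHAUSTIVE-QUERY$(U,W_{\mathrm{thr}})$ queries $q_w(u,v,W_{\mathrm{thr}})$ for every pair in $U$ and returns the edges found. SAMPLE$(W,s)$ returns $W$ if $|W|\le s$, otherwise each element independently with probability $s/|W|$. ESTIMATED-CENTERS$(U,s,W_{\mathrm{thr}})$: $N=|U|$, $A=\emptyset$, $W=U$, $T=Ks\log N\log\log N$ ($K$ a fixed constant); while $W\ne\emptyset$: $A'=$SAMPLE$(W,s)$,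 query $q_d$ on $A'\times U$, $A\leftarrow A\cup A'$; for each $x\in W$ draw a random multiset $X$ of $T$ elements of $U$, query $q_d(y,x,W_{\mathrm{thr}})$ for $y\in X$, set $\tilde C(x)=|\{y\in X:d(x,y)<d(A,y)\}|\cdot N/T$; set $W\leftarrow\{x\in W:\tilde C(x)\ge 5N/s\}$; return $A$. RECONSTRUCT-SUB$(U,W_{\mathrm{thr}})$: $N=|U|$, $s=D\sqrt N$, $A=$ESTIMATED-CENTERS$(U,s,W_{\mathrm{thr}})$; for each $a\in A$: let $N_2(a)$ be the vertices within hop distance $2$ of $a$ in $G[w\ge W_{\mathrm{thr}}]$ (found with $q_w$ queries), query $q_d$ on $N_2(a)\times U$, set $C(b)=\{v\in U:d(b,v)<d(A,v)\}$ for $b\in N_2(a)$, $D_a=N_2(a)\cup\bigcup_{b\in N_2(a)}C(b)$, $E_a=$EXHAUSTIVE-QUERY$(D_a,W_{\mathrm{thr}})$; return $\bigcup_a E_a$. RECONSTRUCT$(U,W_{\mathrm{thr}})$ runs RECONSTRUCT-SUB$(U,W_{\mathrm{thr}})$ and, if it has not terminated after $Q=O(D^3N^{3/2}\log^2N\log\log N)$ queries ($N=|U|$), aborts and restarts from the beginning; it returns the output of the first completed run. LBL-R$(V)$: set $E'=\emptyset$; for $j=0,1,\dots,\lfloor\log_2 W_{\max}\rfloor$: let $W_{\mathrm{thr}}=2^j$ and $\mathcal C=$FIND-CONNECTED-COMPONENTS$(V,W_{\mathrm{thr}})$; for each $c\in\mathcal C$, if $|c|\le n^{1/4}$ add EXHAUSTIVE-QUERY$(c,W_{\mathrm{thr}})$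 to $E'$, otherwise add RECONSTRUCT$(c,W_{\mathrm{thr}})$ to $E'$; if $\max_{c\in\mathcal C}|c|\le n^{1/4}$, break out of the loop. Return $E'$. Here $n=|V|$.
   Formalization: The sample size is s = ⌈D√N⌉ and T is rounded up (0 if negative); with s = D√N unrounded the claim fails, e.g. on a 5-vertex path with unit weights, where ESTIMATED-CENTERS can return the empty set. *)

theory Defs
  imports "HOL-Probability.Probability"
begin

section \<open>Weighted graphs and the three query oracles\<close>

text \<open>Edges are two-element sets of vertices.\<close>

definition weighted_graph :: "'a set \<Rightarrow> 'a set set \<Rightarrow> ('a set \<Rightarrow> real) \<Rightarrow> bool" where
  "weighted_graph V E w \<longleftrightarrow>
     finite V \<and> (\<forall>e\<in>E. e \<subseteq> V \<and> card e = 2) \<and> (\<forall>e\<in>E. w e \<ge> 1)"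

definition max_degree :: "'a set \<Rightarrow> 'a set set \<Rightarrow> nat" where
  "max_degree V E = Max ((\<lambda>v. card {e\<in>E. v \<in> e}) ` V)"

definition max_weight :: "'a set set \<Rightarrow> ('a set \<Rightarrow> real) \<Rightarrow> real" where
  "max_weight E w = Max (w ` E)"

definition weighted_edges :: "'a set set \<Rightarrow> ('a set \<Rightarrow> real) \<Rightarrow> ('a set \<times> real) set" where
  "weighted_edges E w = (\<lambda>e. (e, w e)) ` E"

definition thr_edges :: "'a set set \<Rightarrow> ('a set \<Rightarrow> real) \<Rightarrow> real \<Rightarrow> 'a set set" where
  "thr_edges E w t = {e\<in>E. w e \<ge> t}"

definition is_path :: "'a set \<Rightarrow> 'a set set \<Rightarrow> 'a \<Rightarrow> 'a list \<Rightarrow> 'a \<Rightarrow> bool" where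
  "is_path V F u p v \<longleftrightarrow>
     p \<noteq> [] \<and> hd p = u \<and> last p = v \<and> set p \<subseteq> V \<and> distinct p \<and>
     successively (\<lambda>x y. {x, y} \<in> F) p"

definition path_weight :: "('a set \<Rightarrow> real) \<Rightarrow> 'a list \<Rightarrow> real" where
  "path_weight w p = (\<Sum>(x, y)\<leftarrow>zip p (tl p). w {x, y})"

definition same_component :: "'a set \<Rightarrow> 'a set set \<Rightarrow> 'a \<Rightarrow> 'a \<Rightarrow> bool" where
  "same_component V F u v \<longleftrightarrow> (\<exists>p. is_path V F u p v)"

definition graph_components :: "'a set \<Rightarrow> 'a set set \<Rightarrow> 'a set set" where
  "graph_components V F = (\<lambda>u. {v\<in>V. same_component V F u v}) ` V"

definition q_w :: "'a set set \<Rightarrow> ('a set \<Rightarrow> real) \<Rightarrow> 'a \<Rightarrow> 'a \<Rightarrow> real \<Rightarrow> real" where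
  "q_w E w u v t = (if {u, v} \<in> thr_edges E w t then w {u, v} else 0)"

text \<open>The infimum over the empty set of paths is \<open>\<infinity>\<close>.\<close>

definition q_d :: "'a set \<Rightarrow> 'a set set \<Rightarrow> ('a set \<Rightarrow> real) \<Rightarrow> 'a \<Rightarrow> 'a \<Rightarrow> real \<Rightarrow> ereal" where
  "q_d V E w u v t = (INF p \<in> {p. is_path V (thr_edges E w t) u p v}. ereal (path_weight w p))"

definition q_c :: "'a set \<Rightarrow> 'a set set \<Rightarrow> ('a set \<Rightarrow> real) \<Rightarrow> 'a \<Rightarrow> 'a set \<Rightarrow> real \<Rightarrow> bool" where
  "q_c V E w u S t \<longleftrightarrow> (\<exists>v\<in>S. same_component V (thr_edges E w t) u v)"


section \<open>The algorithm\<close>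

text \<open>
  The algorithm has access to the graph only through the oracles \<open>qw\<close>, \<open>qd\<close>, \<open>qc\<close>, and knows the
  maximum degree \<open>D\<close> and the maximum weight \<open>Wmax\<close>. \<open>K\<close> is the constant in the number of test
  vertices; \<open>Q D N\<close> is the number of queries after which a run on \<open>N\<close> vertices is aborted.

  Randomised procedures are subprobability mass functions; the missing mass is the probability of
  divergence. A procedure that is subject to the abort rule takes the number \<open>b\<close> of queries it may
  still make, and returns \<open>None\<close> if it is aborted and \<open>Some (x, b')\<close> if it completes with result
  \<open>x\<close> and \<open>b'\<close> queries to spare. A batch of queries is charged for as a whole.
\<close>

locale query_algorithm =
  fixes qw :: "'a \<Rightarrow> 'a \<Rightarrow> real \<Rightarrow> real"
    and qd :: "'a \<Rightarrow> 'a \<Rightarrow> real \<Rightarrow> ereal"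
    and qc :: "'a \<Rightarrow> 'a set \<Rightarrow> real \<Rightarrow> bool"
    and D :: nat
    and Wmax :: real
    and K :: real
    and Q :: "nat \<Rightarrow> nat \<Rightarrow> nat"
begin

text \<open>Binary search among the known components \<open>cs\<close>, one of which contains a vertex connected to
  \<open>v\<close>.\<close>

function insert_by_search :: "real \<Rightarrow> 'a \<Rightarrow> 'a set list \<Rightarrow> 'a set list" where
  "insert_by_search t v cs =
     (if length cs \<le> 1 then map (insert v) cs
      else let l = take (length cs div 2) cs; r = drop (length cs div 2) cs
           in if qc v (\<Union>(set l)) t then insert_by_search t v l @ r
              else l @ insert_by_search t v r)"
  by pat_completeness auto
termination
  by (relation "Wellfounded.measure (\<lambda>(t, v, cs). length cs)") auto

definition insert_vertex :: "real \<Rightarrow> 'a \<Rightarrow> 'a set list \<Rightarrow> 'a set list" where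
  "insert_vertex t v cs =
     (if qc v (\<Union>(set cs)) t then insert_by_search t v cs else {v} # cs)"

definition find_connected_components :: "'a list \<Rightarrow> real \<Rightarrow> 'a set list" where
  "find_connected_components vs t = fold (insert_vertex t) vs []"

definition exhaustive_query :: "'a set \<Rightarrow> real \<Rightarrow> ('a set \<times> real) set" where
  "exhaustive_query U t =
     {({u, v}, qw u v t) | u v. u \<in> U \<and> v \<in> U \<and> u \<noteq> v \<and> qw u v t \<noteq> 0}"

definition sample :: "'a set \<Rightarrow> nat \<Rightarrow> 'a set pmf" where
  "sample W s =
     (if card W \<le> s then return_pmf W
      else map_pmf (\<lambda>f. {x\<in>W. f x})
             (Pi_pmf W False (\<lambda>_. bernoulli_pmf (real s / real (card W)))))"

text \<open>\<open>d(A,v)\<close>; it is \<open>\<infinity>\<close> for \<open>A = {}\<close>.\<close>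

definition dist_to :: "real \<Rightarrow> 'a set \<Rightarrow> 'a \<Rightarrow> ereal" where
  "dist_to t A v = (INF a\<in>A. qd a v t)"

text \<open>Independently for each \<open>x \<in> W\<close>, a multiset of \<open>T\<close> independent uniform elements of \<open>U\<close>.\<close>

definition test_vertices :: "'a set \<Rightarrow> nat \<Rightarrow> 'a set \<Rightarrow> ('a \<Rightarrow> 'a multiset) pmf" where
  "test_vertices W T U = Pi_pmf W {#} (\<lambda>_. map_pmf mset (replicate_pmf T (pmf_of_set U)))"

definition cluster_estimate :: "'a set \<Rightarrow> nat \<Rightarrow> real \<Rightarrow> 'a set \<Rightarrow> 'a \<Rightarrow> 'a multiset \<Rightarrow> real" where
  "cluster_estimate U T t A x X =
     real (size {#y \<in># X. qd y x t < dist_to t A y#}) * real (card U) / real T"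

partial_function (spmf) centers_loop ::
  "'a set \<Rightarrow> nat \<Rightarrow> nat \<Rightarrow> real \<Rightarrow> 'a set \<Rightarrow> 'a set \<Rightarrow> nat \<Rightarrow> ('a set \<times> nat) option spmf" where
  "centers_loop U s T t A W b =
     (if W = {} then return_spmf (Some (A, b))
      else bind_spmf (spmf_of_pmf (sample W s)) (\<lambda>A'.
           bind_spmf (spmf_of_pmf (test_vertices W T U)) (\<lambda>X.
             if b < card A' * card U + card W * T then return_spmf None
             else centers_loop U s T t (A \<union> A')
                    {x\<in>W. cluster_estimate U T t (A \<union> A') x (X x)
                             \<ge> 5 * real (card U) / real s}
                    (b - (card A' * card U + card W * T)))))"

definition estimated_centers ::
  "'a set \<Rightarrow> nat \<Rightarrow> real \<Rightarrow> nat \<Rightarrow> ('a set \<times> nat) option spmf" where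
  "estimated_centers U s t b =
     (let N = real (card U); T = nat \<lceil>K * real s * ln N * ln (ln N)\<rceil>
      in centers_loop U s T t {} U b)"

definition nbrs :: "'a set \<Rightarrow> real \<Rightarrow> 'a \<Rightarrow> 'a set" where
  "nbrs U t a = {v\<in>U. qw a v t \<noteq> 0}"

definition nbrs2 :: "'a set \<Rightarrow> real \<Rightarrow> 'a \<Rightarrow> 'a set" where
  "nbrs2 U t a = {a} \<union> nbrs U t a \<union> (\<Union>u\<in>nbrs U t a. nbrs U t u)"

definition cluster :: "'a set \<Rightarrow> real \<Rightarrow> 'a set \<Rightarrow> 'a \<Rightarrow> 'a set" where
  "cluster U t A b = {v\<in>U. qd b v t < dist_to t A v}"

definition extended_cell :: "'a set \<Rightarrow> real \<Rightarrow> 'a set \<Rightarrow> 'a \<Rightarrow> 'a set" where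
  "extended_cell U t A a = nbrs2 U t a \<union> (\<Union>b\<in>nbrs2 U t a. cluster U t A b)"

text \<open>The \<open>qw\<close> queries that determine \<open>nbrs2 U t a\<close>, the \<open>qd\<close> queries on \<open>nbrs2 U t a \<times> U\<close>, and the
  exhaustive query.\<close>

definition cell_cost :: "'a set \<Rightarrow> real \<Rightarrow> 'a set \<Rightarrow> 'a \<Rightarrow> nat" where
  "cell_cost U t A a =
     (1 + card (nbrs U t a)) * card U + card (nbrs2 U t a) * card U
     + (card (extended_cell U t A a) choose 2)"

text \<open>The sample size \<open>s = D \<surd>N\<close> is rounded up. Without rounding, \<open>s < 5\<close> and \<open>s < N\<close> can both hold
  (e.g. \<open>D = 2\<close>, \<open>N = 5\<close>); then the first sample may be empty while every estimate is below
  \<open>5 N / s\<close>, so that an empty set of centers would be returned.\<close>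

definition reconstruct_sub ::
  "'a set \<Rightarrow> real \<Rightarrow> nat \<Rightarrow> (('a set \<times> real) set \<times> nat) option spmf" where
  "reconstruct_sub U t b =
     bind_spmf (estimated_centers U (nat \<lceil>real D * sqrt (real (card U))\<rceil>) t b) (\<lambda>r.
       case r of
         None \<Rightarrow> return_spmf None
       | Some (A, b') \<Rightarrow>
           return_spmf
             (if b' < (\<Sum>a\<in>A. cell_cost U t A a) then None
              else Some (\<Union>a\<in>A. exhaustive_query (extended_cell U t A a) t,
                         b' - (\<Sum>a\<in>A. cell_cost U t A a))))"

partial_function (spmf) reconstruct :: "'a set \<Rightarrow> real \<Rightarrow> ('a set \<times> real) set spmf" where
  "reconstruct U t =
     bind_spmf (reconstruct_sub U t (Q D (card U))) (\<lambda>r.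
       case r of None \<Rightarrow> reconstruct U t | Some x \<Rightarrow> return_spmf (fst x))"

text \<open>In the following, \<open>m\<close> is the size bound \<open>n\<^bsup>1/4\<^esup>\<close> for small components and \<open>F\<close> is the set
  \<open>E'\<close> of edges found so far.\<close>

primrec process_components ::
  "real \<Rightarrow> real \<Rightarrow> 'a set list \<Rightarrow> ('a set \<times> real) set \<Rightarrow> ('a set \<times> real) set spmf" where
  "process_components m t [] F = return_spmf F"
| "process_components m t (c # cs) F =
     bind_spmf (if real (card c) \<le> m then return_spmf (exhaustive_query c t) else reconstruct c t)
       (\<lambda>F'. process_components m t cs (F \<union> F'))"

primrec process_layers ::
  "'a list \<Rightarrow> real \<Rightarrow> nat list \<Rightarrow> ('a set \<times> real) set \<Rightarrow> ('a set \<times> real) set spmf" where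
  "process_layers vs m [] F = return_spmf F"
| "process_layers vs m (j # js) F =
     (let t = 2 ^ j; cs = find_connected_components vs t
      in bind_spmf (process_components m t cs F) (\<lambda>F'.
           if \<forall>c\<in>set cs. real (card c) \<le> m then return_spmf F'
           else process_layers vs m js F'))"

definition lbl_r :: "'a list \<Rightarrow> ('a set \<times> real) set spmf" where
  "lbl_r vs =
     process_layers vs (real (length vs) powr (1/4)) [0..<nat (\<lfloor>log 2 Wmax\<rfloor> + 1)] {}"

end

end

theory Submission
  imports Defs
begin

text \<open>
  The layer with threshold \<open>t = 2^j\<close> finds every edge of weight in \<open>[t, 2 t)\<close>, for any nonempty set
  of centers: two consecutive edges of a shortest path in the layer together weigh at least \<open>2 t\<close>,
  more than the edge in question. These intervals exhaust all weights up to \<open>Wmax\<close>, and breaking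
  early is harmless since the last layer was then queried exhaustively. Completed runs never end with
  an empty set of centers because the sample size is at least the number of vertices or at least
  five. Restarting after each abort terminates almost surely if a run completes with positive
  probability.
\<close>

section \<open>Paths and components\<close>

lemma path_weight_simps [simp]:
  "path_weight w [] = 0" "path_weight w [x] = 0"
  "path_weight w (x # y # p) = w {x, y} + path_weight w (y # p)"
  by (simp_all add: path_weight_def)

text \<open>The cut vertex \<open>y\<close> appears in both pieces, so each edge is counted exactly
  once. This allows a path to be truncated at a given vertex.\<close>

lemma path_weight_append:
  "path_weight w (xs @ y # zs) = path_weight w (xs @ [y]) + path_weight w (y # zs)"
  by (induction xs rule: induct_list012) simp_all

lemma path_weight_nonneg:
  assumes "successively (\<lambda>x y. {x, y} \<in> F) p" "\<And>e. e \<in> F \<Longrightarrow> w e \<ge> 0"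
  shows "path_weight w p \<ge> 0"
  using assms(1) by (induction p rule: induct_list012) (use assms(2) in auto)

lemma is_path_singleton [simp]: "is_path V F u [x] v \<longleftrightarrow> x = u \<and> x = v \<and> u \<in> V"
  by (auto simp: is_path_def)

lemma is_path_ConsD: "is_path V F u (x # y # p) v \<Longrightarrow> is_path V F y (y # p) v"
  by (auto simp: is_path_def)

lemma is_path_rev:
  assumes "is_path V F u p v"
  shows "is_path V F v (rev p) u"
  using assms by (auto simp: is_path_def hd_rev last_rev insert_commute)

text \<open>Paths must be \<open>distinct\<close>, so \<open>v\<close> cannot be appended when it
  already occurs in \<open>p\<close>. In that case \<open>p\<close> is cut at \<open>v\<close>, and
  the discarded rest has nonnegative weight.\<close>

lemma is_path_extend:
  assumes p: "is_path V F u p x" and e: "{x, v} \<in> F" and v: "v \<in> V"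
    and nonneg: "\<And>e. e \<in> F \<Longrightarrow> w e \<ge> 0"
  obtains q where "is_path V F u q v" "path_weight w q \<le> path_weight w p + w {x, v}"
proof (cases "v \<in> set p")
  case False
  from p have "p \<noteq> []" "last p = x" by (auto simp: is_path_def)
  then obtain p' where p': "p = p' @ [x]" by (metis append_butlast_last_id)
  have "is_path V F u (p @ [v]) v"
    using p e v False by (auto simp: is_path_def successively_append_iff)
  moreover have "path_weight w (p @ [v]) = path_weight w p + w {x, v}"
    using path_weight_append[of w p' x "[v]"] by (simp add: p')
  ultimately show ?thesis using that by simp
next
  case True
  then obtain ps qs where ps: "p = ps @ v # qs" by (meson split_list)
  have path: "is_path V F u (ps @ [v]) v"
    using p v unfolding ps by (auto simp: is_path_def successively_append_iff hd_append)
  have "successively (\<lambda>x y. {x, y} \<in> F) (v # qs)"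
    using p unfolding ps by (auto simp: is_path_def successively_append_iff)
  then have "path_weight w (v # qs) \<ge> 0"
    using nonneg by (rule path_weight_nonneg)
  then have "path_weight w (ps @ [v]) \<le> path_weight w p + w {x, v}"
    using nonneg[OF e] path_weight_append[of w ps v qs] by (simp add: ps)
  with path show ?thesis using that by blast
qed

lemma same_component_in:
  "same_component V F u v \<Longrightarrow> u \<in> V" "same_component V F u v \<Longrightarrow> v \<in> V"
  by (auto simp: same_component_def is_path_def)

lemma same_component_refl [simp]: "same_component V F u u \<longleftrightarrow> u \<in> V"
  using same_component_in is_path_singleton[of V F u u u] unfolding same_component_def by metis

lemma same_component_sym: "same_component V F u v \<Longrightarrow> same_component V F v u"
  unfolding same_component_def using is_path_rev by fast

lemma same_component_step:
  assumes "same_component V F u x" "{x, v} \<in> F" "v \<in> V"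
  shows "same_component V F u v"
proof -
  obtain p where "is_path V F u p x" using assms by (auto simp: same_component_def)
  \<comment> \<open>Only the existence of the path matters here; the zero weight satisfies the
    nonnegativity condition trivially.\<close>
  then show ?thesis
    using is_path_extend[of V F u p x v "\<lambda>_. 0"] assms(2,3) by (auto simp: same_component_def)
qed

text \<open>Concatenating two paths may repeat vertices. The first path is therefore extended along
  the second one edge at a time, each step restoring distinctness.\<close>

lemma same_component_trans:
  assumes "same_component V F u x" "same_component V F x v"
  shows "same_component V F u v"
proof -
  have "same_component V F u v" if "same_component V F u x" "is_path V F x p v" for p
    using that
  proof (induction p arbitrary: x rule: induct_list012)
    case (3 a b p)
    then have "x = a" "{a, b} \<in> F" "b \<in> V" by (auto simp: is_path_def)
    with 3 show ?case using same_component_step is_path_ConsD by metis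
  qed (auto simp: is_path_def)
  with assms show ?thesis by (auto simp: same_component_def)
qed

lemma same_component_cong:
  assumes "same_component V F u u'"
  shows "same_component V F u v \<longleftrightarrow> same_component V F u' v"
  using assms same_component_sym same_component_trans by metis

lemma graph_componentsD:
  assumes "U \<in> graph_components V F"
  shows "U \<subseteq> V" "U \<noteq> {}"
    "\<And>u v. u \<in> U \<Longrightarrow> v \<in> U \<longleftrightarrow> same_component V F u v"
proof -
  obtain u where u: "u \<in> V" "U = {v\<in>V. same_component V F u v}"
    using assms by (auto simp: graph_components_def)
  then show "U \<subseteq> V" "U \<noteq> {}" by auto
  fix x v assume "x \<in> U"
  then show "v \<in> U \<longleftrightarrow> same_component V F x v"
    using u same_component_cong[of V F u x v] same_component_in by force
qed

section \<open>Threshold subgraphs and their distances\<close>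

locale finite_weighted_graph =
  fixes V :: "'a set" and E :: "'a set set" and w :: "'a set \<Rightarrow> real"
  assumes graph: "weighted_graph V E w"
begin

lemma finite_V: "finite V"
  using graph by (simp add: weighted_graph_def)

lemma edgeD:
  assumes "{x, y} \<in> E"
  shows "x \<in> V" "y \<in> V" "x \<noteq> y" "w {x, y} \<ge> 1"
  using assms graph by (force simp: weighted_graph_def)+

lemma weight_ge1: "e \<in> E \<Longrightarrow> w e \<ge> 1"
  using graph by (auto simp: weighted_graph_def)

lemma edge_obtain:
  assumes "e \<in> E"
  obtains x y where "e = {x, y}"
  using assms graph by (auto simp: weighted_graph_def card_2_iff)

lemma finite_E: "finite E"
  using graph by (auto simp: weighted_graph_def intro: finite_subset[of E "Pow V"])

lemma thr_edgeD:
  assumes "{x, y} \<in> thr_edges E w t"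
  shows "{x, y} \<in> E" "w {x, y} \<ge> t"
  using assms by (auto simp: thr_edges_def)

text \<open>Edge weights are at least 1, so the answer 0 can only mean that there is no
  edge.\<close>

lemma q_w_nonzero_iff: "q_w E w u v t \<noteq> 0 \<longleftrightarrow> {u, v} \<in> thr_edges E w t"
  using edgeD(4)[of u v] by (auto simp: q_w_def thr_edges_def)

lemma q_d_le: "is_path V (thr_edges E w t) u p v \<Longrightarrow> q_d V E w u v t \<le> ereal (path_weight w p)"
  unfolding q_d_def by (rule INF_lower) simp

text \<open>A finite vertex set has only finitely many distinct paths, so the infimum is a minimum
  once a path exists.\<close>

lemma q_d_attained:
  assumes "same_component V (thr_edges E w t) u v"
  obtains p where "is_path V (thr_edges E w t) u p v" "q_d V E w u v t = ereal (path_weight w p)"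
proof -
  let ?P = "{p. is_path V (thr_edges E w t) u p v}"
  have "?P \<subseteq> {p. set p \<subseteq> V \<and> distinct p}" by (auto simp: is_path_def)
  then have "finite ?P" using finite_subset_distinct[OF finite_V] by (rule finite_subset)
  moreover have "?P \<noteq> {}" using assms by (auto simp: same_component_def)
  ultimately have "Inf ((\<lambda>p. ereal (path_weight w p)) ` ?P) \<in> (\<lambda>p. ereal (path_weight w p)) ` ?P"
    by (metis Min_in Min_Inf finite_imageI image_is_empty)
  then show ?thesis using that by (auto simp: q_d_def)
qed

lemma q_d_finite: "same_component V (thr_edges E w t) u v \<Longrightarrow> q_d V E w u v t < \<infinity>"
  by (erule q_d_attained) simp

lemma q_d_extend_le:
  assumes "is_path V (thr_edges E w t) u p x" "{x, v} \<in> thr_edges E w t"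
  shows "q_d V E w u v t \<le> ereal (path_weight w p + w {x, v})"
proof -
  have nn: "w e \<ge> 0" if "e \<in> thr_edges E w t" for e
    using that weight_ge1[of e] by (auto simp: thr_edges_def)
  have "v \<in> V" using assms(2) thr_edgeD edgeD by metis
  then obtain q where "is_path V (thr_edges E w t) u q v"
      "path_weight w q \<le> path_weight w p + w {x, v}"
    using is_path_extend[OF assms] nn by metis
  then show ?thesis by (meson q_d_le ereal_less_eq(3) order_trans)
qed

lemma component_neighbour:
  assumes "U \<in> graph_components V (thr_edges E w t)" "x \<in> U" "{x, y} \<in> thr_edges E w t"
  shows "y \<in> U"
  using assms graph_componentsD[OF assms(1)] same_component_step thr_edgeD edgeD
  by (metis same_component_refl subsetD)

section \<open>Lower bounds on the maximum degree\<close>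

lemma degree_le_max_degree:
  assumes "v \<in> V" "B \<subseteq> E" "\<And>e. e \<in> B \<Longrightarrow> v \<in> e"
  shows "card B \<le> max_degree V E"
proof -
  have "card B \<le> card {e\<in>E. v \<in> e}"
    using assms finite_E by (intro card_mono) auto
  also have "\<dots> \<le> max_degree V E"
    unfolding max_degree_def using assms(1) finite_V by (intro Max_ge) auto
  finally show ?thesis .
qed

lemma two_neighbours_max_degree:
  assumes "{v, x} \<in> E" "{v, y} \<in> E" "x \<noteq> y"
  shows "max_degree V E \<ge> 2"
proof -
  have "card {{v, x}, {v, y}} \<le> max_degree V E"
    using assms edgeD by (intro degree_le_max_degree[of v]) auto
  moreover have "{v, x} \<noteq> {v, y}" using assms by (auto simp: doubleton_eq_iff)
  ultimately show ?thesis by simp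
qed

text \<open>From a fixed vertex \<open>u\<close>, the path to another vertex \<open>v\<close> is
  either a single edge or has a second vertex with two distinct neighbours. If two other vertices
  are both adjacent to \<open>u\<close>, then \<open>u\<close> itself has degree at least 2. These
  bounds make the sample size large enough on small components.\<close>

lemma component_max_degree:
  assumes U: "U \<in> graph_components V (thr_edges E w t)"
  shows "card U \<ge> 2 \<Longrightarrow> max_degree V E \<ge> 1" "card U \<ge> 3 \<Longrightarrow> max_degree V E \<ge> 2"
proof -
  note UD = graph_componentsD[OF U]
  obtain u where u: "u \<in> U" using UD by auto
  have fin: "finite U" using UD finite_V finite_subset by metis
  have path: "{u, v} \<in> E \<or> max_degree V E \<ge> 2" if v: "v \<in> U - {u}" for v
  proof -
    obtain p where p: "is_path V (thr_edges E w t) u p v"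
      using v UD(3)[OF u] by (auto simp: same_component_def)
    show ?thesis
    proof (cases p rule: remdups_adj.cases)
      case (3 a b q)
      with p have ab: "a = u" "{u, b} \<in> E"
        by (auto simp: is_path_def dest: thr_edgeD)
      show ?thesis
      proof (cases q)
        case Nil
        with 3 p ab show ?thesis by (auto simp: is_path_def)
      next
        case (Cons c r)
        with 3 p ab have "{b, a} \<in> E" "{b, c} \<in> E" "a \<noteq> c"
          by (auto simp: is_path_def insert_commute dest: thr_edgeD)
        then show ?thesis using two_neighbours_max_degree by metis
      qed
    qed (use p v in \<open>auto simp: is_path_def\<close>)
  qed
  {
    assume "card U \<ge> 2"
    then have "card (U - {u}) \<ge> 1" using u fin by simp
    then obtain v where "v \<in> U - {u}" by (metis card.empty equals0I not_one_le_zero)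
    with path have *: "{u, v} \<in> E \<or> max_degree V E \<ge> 2" by blast
    show "max_degree V E \<ge> 1"
    proof (cases "{u, v} \<in> E")
      case True
      then show ?thesis using degree_le_max_degree[of u "{{u, v}}"] edgeD[of u v] by auto
    qed (use * in auto)
  }
  {
    assume "card U \<ge> 3"
    then have "card (U - {u}) \<ge> 2" using u fin by simp
    then obtain B where "B \<subseteq> U - {u}" "card B = 2" by (meson obtain_subset_with_card_n)
    then obtain v v' where "v \<in> U - {u}" "v' \<in> U - {u}" "v \<noteq> v'"
      by (auto simp: card_2_iff)
    then show "max_degree V E \<ge> 2" using path two_neighbours_max_degree by metis
  }
qed

end

section \<open>Subprobability mass functions\<close>

text \<open>Separates partial correctness from almost sure termination, which are proved
  independently.\<close>

lemma eq_return_spmf_iff: "p = return_spmf x \<longleftrightarrow> (\<forall>y\<in>set_spmf p. y = x) \<and> lossless_spmf p"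
  using bind_eq_return_spmf[of p return_spmf x] by auto

lemma set_bind_spmf_iff: "y \<in> set_spmf (bind_spmf p f) \<longleftrightarrow> (\<exists>x\<in>set_spmf p. y \<in> set_spmf (f x))"
  by (auto simp: set_bind_spmf)

text \<open>The weight \<open>r\<close> of \<open>q\<close> satisfies \<open>r = c r + (1 - c)\<close>, where \<open>c < 1\<close> is the probability of
  \<open>None\<close>.\<close>

lemma lossless_retry:
  assumes q: "q = bind_spmf p (\<lambda>r. case r of None \<Rightarrow> q | Some x \<Rightarrow> return_spmf (g x))"
    and p: "lossless_spmf p" and x: "Some x \<in> set_spmf p"
  shows "lossless_spmf q"
proof -
  define c where "c = measure (measure_spmf p) {None}"
  interpret prob_space "measure_spmf p"
    using p by (intro prob_spaceI) (simp add: lossless_spmf_def space_measure_spmf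
      measure_spmf.emeasure_eq_measure)
  \<comment> \<open>\<open>?f r\<close> is the weight of what follows the outcome \<open>r\<close>:
    \<open>weight_spmf q\<close> after \<open>None\<close>, and 1 after any completed run.\<close>
  let ?f = "\<lambda>r. 1 - (1 - weight_spmf q) * indicator {None} r :: real"
  have "weight_spmf q = (\<integral>r. ?f r \<partial>measure_spmf p)"
  proof -
    have "weight_spmf q = weight_spmf (bind_spmf p (\<lambda>r. case r of None \<Rightarrow> q | Some x \<Rightarrow> return_spmf (g x)))"
      using q by metis
    also have "\<dots> = (\<integral>r. ?f r \<partial>measure_spmf p)"
      unfolding weight_bind_spmf
      by (intro Bochner_Integration.integral_cong) (auto split: option.split)
    finally show ?thesis .
  qed
  also have "\<dots> = 1 - (1 - weight_spmf q) * c"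
    by (subst Bochner_Integration.integral_diff)
      (auto simp: c_def prob_space less_top[symmetric])
  finally have "(1 - weight_spmf q) * (1 - c) = 0" by (simp add: algebra_simps)
  moreover have "c < 1"
  proof -
    have "spmf p (Some x) > 0" using x by (simp add: in_set_spmf_iff_spmf less_le)
    moreover have "c + spmf p (Some x) = measure (measure_spmf p) ({None} \<union> {Some x})"
      unfolding c_def spmf_conv_measure_spmf by (subst measure_spmf.finite_measure_Union) auto
    moreover have "\<dots> \<le> 1" by (rule prob_le_1)
    ultimately show ?thesis by linarith
  qed
  ultimately show ?thesis by (simp add: lossless_spmf_def)
qed


section \<open>The algorithm\<close>

locale query_setting = finite_weighted_graph V E w
  for V :: "'a set" and E :: "'a set set" and w :: "'a set \<Rightarrow> real" +
  fixes D :: nat and Wmax :: real and K :: real and Q :: "nat \<Rightarrow> nat \<Rightarrow> nat"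
  assumes D: "D = max_degree V E" and Wmax: "Wmax = max_weight E w" and K: "K > 0"
begin

sublocale query_algorithm "q_w E w" "q_d V E w" "q_c V E w" D Wmax K Q .

section \<open>Correctness of the component search\<close>

lemma q_c_Union: "q_c V E w v (\<Union>(set cs)) t \<longleftrightarrow> (\<exists>c\<in>set cs. q_c V E w v c t)"
  by (auto simp: q_c_def)

declare insert_by_search.simps [simp del]

text \<open>Since at most one entry answers the query positively, the half that is not searched
  needs no change. Writing the result as a \<open>map\<close> keeps all positions, from which both
  its distinctness and its set can be read off.\<close>

lemma insert_by_search_eq:
  assumes "distinct cs" "\<exists>c\<in>set cs. q_c V E w v c t"
    and "\<And>c c'. \<lbrakk>c \<in> set cs; c' \<in> set cs; q_c V E w v c t; q_c V E w v c' t\<rbrakk> \<Longrightarrow> c = c'"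
  shows "insert_by_search t v cs = map (\<lambda>c. if q_c V E w v c t then insert v c else c) cs"
  using assms
proof (induction cs rule: measure_induct_rule[where f = length])
  case (less cs)
  let ?f = "\<lambda>c. if q_c V E w v c t then insert v c else c"
  show ?case
  proof (cases "length cs \<le> 1")
    case True
    with less.prems obtain c where "cs = [c]" by (cases cs) auto
    with less.prems show ?thesis by (auto simp: insert_by_search.simps)
  next
    case False
    define l r where "l = take (length cs div 2) cs" and "r = drop (length cs div 2) cs"
    have cs: "cs = l @ r" by (simp add: l_def r_def)
    have len: "length l < length cs" "length r < length cs" using False by (auto simp: l_def r_def)
    have step: "insert_by_search t v cs =
        (if \<exists>c\<in>set l. q_c V E w v c t then insert_by_search t v l @ r
         else l @ insert_by_search t v r)"
      using False by (subst insert_by_search.simps) (simp add: l_def r_def q_c_Union Let_def)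
    show ?thesis
    proof (cases "\<exists>c\<in>set l. q_c V E w v c t")
      case True
      then have "\<not> q_c V E w v c t" if "c \<in> set r" for c
        using that less.prems unfolding cs by auto
      then have "map ?f r = r" by (simp add: map_idI)
      moreover have "insert_by_search t v l = map ?f l"
        using less.prems len True by (intro less.IH) (auto simp: cs)
      ultimately show ?thesis unfolding step using True by (simp add: cs)
    next
      case False
      then have "map ?f l = l" by (simp add: map_idI)
      moreover have "insert_by_search t v r = map ?f r"
        using less.prems len False by (intro less.IH) (auto simp: cs)
      ultimately show ?thesis unfolding step using False by (simp add: cs)
    qed
  qed
qed

text \<open>Connectivity refers to all of \<open>V\<close>, even while only \<open>vs\<close> has
  been inserted. A new vertex thus belongs to at most one existing class and never merges two of
  them. Distinctness is carried along because the binary search relies on it.\<close>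

lemma find_connected_components_aux:
  assumes "distinct vs" "set vs \<subseteq> V"
  shows "distinct (find_connected_components vs t) \<and>
    set (find_connected_components vs t) =
      (\<lambda>u. {v\<in>set vs. same_component V (thr_edges E w t) u v}) ` set vs"
  using assms
proof (induction vs rule: rev_induct)
  case Nil
  then show ?case by (simp add: find_connected_components_def)
next
  case (snoc x vs)
  let ?same = "same_component V (thr_edges E w t)"
  let ?C = "\<lambda>u. {v\<in>set vs. ?same u v}"
  let ?C' = "\<lambda>u. {v\<in>insert x (set vs). ?same u v}"
  define cs where "cs = find_connected_components vs t"
  have cs: "distinct cs" "set cs = ?C ` set vs" using snoc by (auto simp: cs_def)
  have x: "x \<notin> set vs" "x \<in> V" "set vs \<subseteq> V" using snoc by auto
  have step: "find_connected_components (vs @ [x]) t = insert_vertex t x cs"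
    by (simp add: find_connected_components_def cs_def)
  have qc: "q_c V E w x (?C u) t \<longleftrightarrow> ?same u x" if "u \<in> set vs" for u
  proof
    assume "q_c V E w x (?C u) t"
    then obtain v where "?same x v" "?same u v" by (auto simp: q_c_def)
    then show "?same u x" using same_component_sym same_component_trans by fast
  next
    assume "?same u x"
    moreover have "u \<in> ?C u" using that x by auto
    ultimately show "q_c V E w x (?C u) t"
      unfolding q_c_def using same_component_sym by fast
  qed
  have C_eq: "?C u = ?C u'" "?C' u = ?C' u'" if "?same u u'" for u u'
    using same_component_cong[OF that] by auto
  show ?case
  proof (cases "\<exists>u\<in>set vs. ?same u x")
    case True
    then obtain u where u: "u \<in> set vs" "?same u x" by blast
    let ?f = "\<lambda>c. if q_c V E w x c t then insert x c else c"
    have f: "?f (?C u) = ?C' u" if "u \<in> set vs" for u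
      using qc[OF that] by auto
    have "q_c V E w x (\<Union>(set cs)) t"
      unfolding q_c_Union unfolding cs(2) using u qc by auto
    then have "insert_vertex t x cs = insert_by_search t x cs"
      by (simp add: insert_vertex_def)
    also have "\<dots> = map ?f cs"
    proof (rule insert_by_search_eq)
      show "\<exists>c\<in>set cs. q_c V E w x c t" unfolding cs using u qc by auto
    next
      fix c c' assume "c \<in> set cs" "c' \<in> set cs" "q_c V E w x c t" "q_c V E w x c' t"
      then obtain a a' where "c = ?C a" "c' = ?C a'" "?same a x" "?same a' x"
        using qc unfolding cs by blast
      then show "c = c'" using C_eq(1)[of a x] C_eq(1)[of a' x] by simp
    qed (rule cs)
    finally have eq: "insert_vertex t x cs = map ?f cs" .
    \<comment> \<open>The new vertex \<open>x\<close> lies in no old class, so removing it recovers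
      the class.\<close>
    have "inj_on ?f (set cs)"
    proof (rule inj_onI)
      fix c c' assume "c \<in> set cs" "c' \<in> set cs" "?f c = ?f c'"
      moreover from this have "x \<notin> c" "x \<notin> c'" using x cs by auto
      ultimately show "c = c'" by (auto split: if_splits)
    qed
    moreover have "?f ` set cs = ?C' ` insert x (set vs)"
    proof -
      have "?f ` set cs = ?C' ` set vs"
        unfolding cs image_image using f by (intro image_cong) auto
      moreover have "?C' x \<in> ?C' ` set vs" using u C_eq(2)[of u x] by blast
      ultimately show ?thesis by auto
    qed
    ultimately show ?thesis
      unfolding step eq using cs by (simp add: distinct_map)
  next
    case False
    then have "\<not> q_c V E w x (\<Union>(set cs)) t"
      unfolding q_c_Union unfolding cs(2) using qc by auto
    then have eq: "insert_vertex t x cs = {x} # cs" by (simp add: insert_vertex_def)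
    have "?C' ` set vs = ?C ` set vs" using False by (intro image_cong) auto
    moreover have "?C' x = {x}"
      using False x same_component_sym[of V _ x] by auto
    ultimately have "set ({x} # cs) = ?C' ` insert x (set vs)" using cs by simp
    moreover have "distinct ({x} # cs)" using cs x by auto
    ultimately show ?thesis unfolding step eq by simp
  qed
qed

lemma set_find_connected_components:
  assumes "distinct vs" "set vs = V"
  shows "set (find_connected_components vs t) = graph_components V (thr_edges E w t)"
  using find_connected_components_aux[of vs t] assms by (simp add: graph_components_def)

section \<open>Exhaustive queries and extended cells\<close>

lemma exhaustive_query_subset: "exhaustive_query U t \<subseteq> weighted_edges E w"
  by (auto simp: exhaustive_query_def weighted_edges_def q_w_def thr_edges_def)

lemma in_exhaustive_query:
  assumes "{u, v} \<in> thr_edges E w t" "u \<in> U" "v \<in> U"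
  shows "({u, v}, w {u, v}) \<in> exhaustive_query U t"
proof -
  have "u \<noteq> v" using assms thr_edgeD edgeD by metis
  moreover have "q_w E w u v t = w {u, v}" using assms by (simp add: q_w_def)
  moreover have "q_w E w u v t \<noteq> 0" using assms q_w_nonzero_iff by blast
  ultimately show ?thesis using assms unfolding exhaustive_query_def by force
qed

lemma nbrs_eq:
  assumes "U \<in> graph_components V (thr_edges E w t)" "a \<in> U"
  shows "nbrs U t a = {v. {a, v} \<in> thr_edges E w t}"
  using component_neighbour[OF assms] by (auto simp: nbrs_def q_w_nonzero_iff)

text \<open>If the shortest path from the nearest center \<open>a\<close> to \<open>u\<close> has at least two edges, let \<open>b\<close> be its
  third vertex. Its first two edges weigh at least \<open>2 t > w {u, v}\<close> together, so \<open>b\<close> is closer than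
  \<open>A\<close> to both \<open>u\<close> and \<open>v\<close>.\<close>

lemma extended_cell_covers_aux:
  assumes U: "U \<in> graph_components V (thr_edges E w t)"
    and A: "A \<subseteq> U" "A \<noteq> {}" and u: "u \<in> U"
    and e: "{u, v} \<in> thr_edges E w t" and light: "w {u, v} < 2 * t"
    and le: "dist_to t A u \<le> dist_to t A v"
  shows "\<exists>a\<in>A. u \<in> extended_cell U t A a \<and> v \<in> extended_cell U t A a"
proof -
  let ?F = "thr_edges E w t"
  note UD = graph_componentsD[OF U]
  have v: "v \<in> U" using component_neighbour[OF U u e] .
  have "finite A" using A UD finite_V by (meson finite_subset)
  then have "dist_to t A u \<in> (\<lambda>a. q_d V E w a u t) ` A"
    unfolding dist_to_def using A by (metis Min_in Min_Inf finite_imageI image_is_empty)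
  then obtain a where a: "a \<in> A" "dist_to t A u = q_d V E w a u t" by auto
  have aU: "a \<in> U" using a A by auto
  obtain p where p: "is_path V ?F a p u" "q_d V E w a u t = ereal (path_weight w p)"
    using q_d_attained UD(3)[OF aU] u by metis
  \<comment> \<open>The split is by the number of edges of \<open>p\<close>. With at most one edge,
    \<open>u\<close> and \<open>v\<close> are within two hops of \<open>a\<close>, so
    \<open>nbrs2\<close> already contains both.\<close>
  consider "p = [a]" "u = a" | "p = [a, u]" "{a, u} \<in> ?F"
    | x b r where "p = a # x # b # r" "{a, x} \<in> ?F" "{x, b} \<in> ?F" "is_path V ?F b (b # r) u"
  proof (cases p rule: remdups_adj.cases)
    case (3 y x q)
    then show ?thesis
    proof (cases q)
      case (Cons b r)
      with \<open>p = y # x # q\<close> p that(3) show ?thesis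
        by (metis is_path_ConsD is_path_def list.sel(1) successively.simps(3))
    qed (use 3 p that in \<open>auto simp: is_path_def\<close>)
  qed (use p that in \<open>auto simp: is_path_def\<close>)
  then show ?thesis
  proof cases
    case 1
    then have "u \<in> nbrs2 U t a" "v \<in> nbrs2 U t a"
      using nbrs_eq[OF U aU] e by (auto simp: nbrs2_def)
    then show ?thesis using a by (auto simp: extended_cell_def)
  next
    case 2
    then have "u \<in> nbrs2 U t a" "v \<in> nbrs2 U t a"
      using nbrs_eq[OF U aU] nbrs_eq[OF U u] e by (auto simp: nbrs2_def)
    then show ?thesis using a by (auto simp: extended_cell_def)
  next
    case 3
    have "x \<in> U" using component_neighbour[OF U aU 3(2)] .
    then have b: "b \<in> nbrs2 U t a"
      using nbrs_eq[OF U aU] nbrs_eq[OF U, of x] 3 by (auto simp: nbrs2_def)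
    \<comment> \<open>Positivity of \<open>w {u, v}\<close> and \<open>w {u, v} < 2 * t\<close>
      force \<open>t > 0\<close>, so dropping the first two edges of the path strictly decreases its
      weight.\<close>
    have wt: "w {a, x} \<ge> t" "w {x, b} \<ge> t" "w {u, v} > 0"
      using 3 e thr_edgeD edgeD(4)[of u v] by fastforce+
    have dist: "dist_to t A u = ereal (w {a, x} + w {x, b} + path_weight w (b # r))"
      using a p 3 by simp
    have "q_d V E w b u t \<le> ereal (path_weight w (b # r))" using 3 q_d_le by blast
    also have "\<dots> < dist_to t A u" unfolding dist using wt light by simp
    finally have u_in: "u \<in> cluster U t A b" using u by (simp add: cluster_def)
    have "q_d V E w b v t \<le> ereal (path_weight w (b # r) + w {u, v})"
      using q_d_extend_le 3(4) e by blast
    also have "\<dots> < dist_to t A u" unfolding dist using wt light by simp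
    also note le
    finally have "v \<in> cluster U t A b" using v by (simp add: cluster_def)
    with u_in show ?thesis using a b by (auto simp: extended_cell_def)
  qed
qed

text \<open>Edges are undirected, so the endpoint that is no farther from \<open>A\<close> can take
  the role of \<open>u\<close>.\<close>

lemma extended_cell_covers:
  assumes U: "U \<in> graph_components V (thr_edges E w t)"
    and A: "A \<subseteq> U" "A \<noteq> {}" and u: "u \<in> U"
    and e: "{u, v} \<in> thr_edges E w t" and light: "w {u, v} < 2 * t"
  shows "\<exists>a\<in>A. u \<in> extended_cell U t A a \<and> v \<in> extended_cell U t A a"
proof (cases "dist_to t A u \<le> dist_to t A v")
  case True
  then show ?thesis using extended_cell_covers_aux[OF assms] by blast
next
  case False
  then have "dist_to t A v \<le> dist_to t A u" by simp
  then show ?thesis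
    using extended_cell_covers_aux[OF U A component_neighbour[OF U u e], of u] e light
    by (auto simp: insert_commute)
qed

section \<open>Choosing the centers\<close>

lemma sample_subset: "S \<in> set_pmf (sample W s) \<Longrightarrow> S \<subseteq> W"
  by (auto simp: sample_def split: if_splits)

lemma sample_small: "card W \<le> s \<Longrightarrow> sample W s = return_pmf W"
  by (simp add: sample_def)

text \<open>While no center has been chosen, every estimate equals \<open>card U \<ge> 5 * card U / s\<close>, so no vertex
  is dropped and the loop cannot end without centers. Every round costs at least one query, so the
  budget forces termination.\<close>

lemma centers_loop_correct:
  assumes U: "U \<in> graph_components V (thr_edges E w t)"
    and params: "card U \<le> s \<or> T \<ge> 1 \<and> s \<ge> 5"
  shows "\<lbrakk>A \<subseteq> U; W \<subseteq> U; A = {} \<Longrightarrow> W = U\<rbrakk> \<Longrightarrow>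
    lossless_spmf (centers_loop U s T t A W b) \<and>
    (\<forall>A' b'. Some (A', b') \<in> set_spmf (centers_loop U s T t A W b) \<longrightarrow> A' \<subseteq> U \<and> A' \<noteq> {})"
proof (induction b arbitrary: A W rule: less_induct)
  case (less b)
  note UD = graph_componentsD[OF U]
  have fin: "finite U" "finite W" using UD finite_V less.prems by (meson finite_subset)+
  show ?case
  proof (cases "W = {}")
    case True
    then show ?thesis
      using less.prems UD by (subst (1 2) centers_loop.simps) auto
  next
    case False
    define cost where "cost S = card S * card U + card W * T" for S :: "'a set"
    define next_W where "next_W S X =
      {x\<in>W. cluster_estimate U T t (A \<union> S) x (X x) \<ge> 5 * real (card U) / real s}"
      for S and X :: "'a \<Rightarrow> 'a multiset"
    define step where "step = (\<lambda>S X. if b < cost S then return_spmf None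
       else centers_loop U s T t (A \<union> S) (next_W S X) (b - cost S))"
    have loop: "centers_loop U s T t A W b =
        bind_spmf (spmf_of_pmf (sample W s)) (\<lambda>S.
          bind_spmf (spmf_of_pmf (test_vertices W T U)) (step S))"
      unfolding step_def cost_def next_W_def using False by (subst centers_loop.simps) simp
    have *: "lossless_spmf (step S X) \<and>
        (\<forall>A' b'. Some (A', b') \<in> set_spmf (step S X) \<longrightarrow> A' \<subseteq> U \<and> A' \<noteq> {})"
      if S: "S \<in> set_pmf (sample W s)" and X: "X \<in> set_pmf (test_vertices W T U)" for S X
    proof (cases "b < cost S")
      case True
      then show ?thesis by (simp add: step_def)
    next
      case enough: False
      have "card W \<le> card U" using less.prems fin by (simp add: card_mono)
      then have small: "S = W" if "card U \<le> s"
        using S that sample_small[of W s] by simp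
      \<comment> \<open>If the sample is all of the nonempty \<open>W\<close>, its distance queries
        are charged; otherwise \<open>T \<ge> 1\<close> and the tests of \<open>W\<close> are
        charged.\<close>
      have "cost S \<ge> 1"
      proof (cases "card U \<le> s")
        case True
        then have "S = W" by (rule small)
        then show ?thesis using False fin UD by (simp add: cost_def Suc_le_eq card_gt_0_iff)
      next
        case False
        then show ?thesis using params \<open>W \<noteq> {}\<close> fin by (simp add: cost_def Suc_le_eq card_gt_0_iff)
      qed
      then have "b - cost S < b" using enough by simp
      moreover have "A \<union> S \<subseteq> U" using sample_subset[OF S] less.prems by blast
      moreover have "next_W S X \<subseteq> U" using less.prems by (auto simp: next_W_def)
      moreover have "next_W S X = U" if "A \<union> S = {}"
      proof -
        have W: "W = U" and AS: "A = {}" "S = {}" using that less.prems by auto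
        \<comment> \<open>\<open>card U \<le> s\<close> would make \<open>S\<close> equal to the
          nonempty \<open>W\<close>, so the second alternative of \<open>params\<close> must
          hold.\<close>
        then have Ts: "T \<ge> 1" "s \<ge> 5" using small params False by auto
        have "cluster_estimate U T t (A \<union> S) x (X x) = card U" if x: "x \<in> U" for x
        proof -
          have "X x \<in> set_pmf (map_pmf mset (replicate_pmf T (pmf_of_set U)))"
            using X x fin set_Pi_pmf_subset'[of W "{#}" "\<lambda>_. map_pmf mset (replicate_pmf T (pmf_of_set U))"]
            unfolding test_vertices_def W by (auto simp: PiE_dflt_def)
          then obtain ys where ys: "X x = mset ys" "\<forall>y\<in>set ys. y \<in> U" "length ys = T"
            using fin(1) UD(2) by (auto simp: set_replicate_pmf set_pmf_of_set)
          \<comment> \<open>Distances within a component are finite, whereas the distance to the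
            empty set is \<infinity>; hence every test vertex is counted.\<close>
          have "q_d V E w y x t < dist_to t (A \<union> S) y" if "y \<in> set ys" for y
            using q_d_finite UD(3)[of y x] ys x that by (auto simp: dist_to_def AS top_ereal_def)
          then have "filter_mset (\<lambda>y. q_d V E w y x t < dist_to t (A \<union> S) y) (X x) = X x"
            by (simp add: ys flip: mset_filter)
          then show ?thesis using ys Ts by (simp add: cluster_estimate_def)
        qed
        moreover have "5 * real (card U) / real s \<le> real (card U)"
          using Ts mult_right_mono[of 5 "real s" "real (card U)"]
          by (simp add: divide_le_eq mult.commute)
        ultimately show ?thesis by (auto simp: next_W_def W)
      qed
      ultimately have "lossless_spmf (centers_loop U s T t (A \<union> S) (next_W S X) (b - cost S)) \<and>
          (\<forall>A' b'. Some (A', b') \<in> set_spmf (centers_loop U s T t (A \<union> S) (next_W S X) (b - cost S))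
            \<longrightarrow> A' \<subseteq> U \<and> A' \<noteq> {})"
        by (rule less.IH)
      then show ?thesis unfolding step_def if_not_P[OF enough] .
    qed
    have "lossless_spmf (centers_loop U s T t A W b)"
      unfolding loop using * by auto
    moreover have "A' \<subseteq> U \<and> A' \<noteq> {}"
      if result: "Some (A', b') \<in> set_spmf (centers_loop U s T t A W b)" for A' b'
    proof -
      obtain S X where "S \<in> set_pmf (sample W s)" "X \<in> set_pmf (test_vertices W T U)"
        "Some (A', b') \<in> set_spmf (step S X)"
        using result unfolding loop set_bind_spmf_iff by auto
      then show ?thesis using * by blast
    qed
    ultimately show ?thesis by blast
  qed
qed

text \<open>For two vertices \<open>D \<ge> 1\<close> suffices, and for three to five vertices
  \<open>D \<ge> 2\<close> does, to make the rounded sample size reach \<open>card U\<close>. From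
  six vertices on, \<open>2 * sqrt N > 4\<close> gives \<open>s \<ge> 5\<close>, and the iterated
  logarithm in \<open>T\<close> is positive.\<close>

lemma sample_size_params:
  assumes U: "U \<in> graph_components V (thr_edges E w t)" and N: "card U \<ge> 2"
    and s: "s = nat \<lceil>real D * sqrt (real (card U))\<rceil>"
    and T: "T = nat \<lceil>K * real s * ln (real (card U)) * ln (ln (real (card U)))\<rceil>"
  shows "card U \<le> s \<or> T \<ge> 1 \<and> s \<ge> 5"
proof -
  have D1: "D \<ge> 1" and D2: "card U \<ge> 3 \<Longrightarrow> D \<ge> 2"
    using component_max_degree[OF U] N by (auto simp: D)
  \<comment> \<open>The value before rounding up only has to exceed \<open>k - 1\<close>;
    \<open>d\<close> will be the known lower bound 1 or 2 on the degree.\<close>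
  have s_ge: "k \<le> s" if "real k - 1 < real d * sqrt (real (card U))" "d \<le> D" for k d
  proof -
    have "real k - 1 < real D * sqrt (real (card U))"
      using that by (smt (verit) mult_right_mono of_nat_le_iff of_nat_0_le_iff real_sqrt_ge_zero)
    then have "int k - 1 < \<lceil>real D * sqrt (real (card U))\<rceil>"
      by (simp add: less_ceiling_iff)
    then show ?thesis unfolding s by linarith
  qed
  have sq: "x < sqrt y" if "x * x < y" "x \<ge> 0" for x y :: real
    using that by (simp add: real_less_rsqrt power2_eq_square)
  consider "card U = 2" | "card U = 3" | "card U = 4" | "card U = 5" | "card U \<ge> 6"
    using N by linarith
  then show ?thesis
  proof cases
    case 1
    then show ?thesis using s_ge[of 2 1] sq[of 1 2] D1 by simp
  next
    case 2
    then show ?thesis using s_ge[of 3 2] sq[of 1 3] D2 by simp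
  next
    case 3
    then show ?thesis using s_ge[of 4 2] sq[of "3/2" 4] D2 by simp
  next
    case 4
    then show ?thesis using s_ge[of 5 2] sq[of 2 5] D2 by simp
  next
    case 5
    then have "2 < sqrt (real (card U))" using sq[of 2 "real (card U)"] by simp
    then have s5: "s \<ge> 5" using s_ge[of 5 2] D2 5 by simp
    \<comment> \<open>Six vertices exceed Euler's number, so \<open>ln (ln N)\<close> is positive
      and the ceiling defining \<open>T\<close> is at least 1.\<close>
    have "exp 1 < exp (ln (real (card U)))" using 5 exp_le by simp
    then have "ln (real (card U)) > 1" by simp
    then have "K * real s * ln (real (card U)) * ln (ln (real (card U))) > 0"
      using K s5 by simp
    then have "T \<ge> 1" unfolding T by linarith
    with s5 show ?thesis by simp
  qed
qed

lemma estimated_centers_correct: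
  assumes U: "U \<in> graph_components V (thr_edges E w t)" and N: "card U \<ge> 2"
  shows "lossless_spmf (estimated_centers U (nat \<lceil>real D * sqrt (real (card U))\<rceil>) t b)"
    "Some (A, b') \<in> set_spmf (estimated_centers U (nat \<lceil>real D * sqrt (real (card U))\<rceil>) t b)
      \<Longrightarrow> A \<subseteq> U \<and> A \<noteq> {}"
  using centers_loop_correct[OF U sample_size_params[OF U N refl refl], of "{}" U b]
  unfolding estimated_centers_def Let_def by auto

section \<open>Reconstruction of a single component\<close>

lemma lossless_reconstruct_sub:
  assumes "U \<in> graph_components V (thr_edges E w t)" "card U \<ge> 2"
  shows "lossless_spmf (reconstruct_sub U t b)"
  using estimated_centers_correct(1)[OF assms]
  by (auto simp: reconstruct_sub_def split: option.split)

text \<open>This is what one layer guarantees: no false edges, and all edges at \<open>U\<close>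
  with weight in \<open>[t, 2 * t)\<close>. Heavier edges are left to later layers.\<close>

definition finds_light_edges :: "'a set \<Rightarrow> real \<Rightarrow> ('a set \<times> real) set \<Rightarrow> bool" where
  "finds_light_edges U t F \<longleftrightarrow> F \<subseteq> weighted_edges E w \<and>
     (\<forall>u v. u \<in> U \<longrightarrow> {u, v} \<in> thr_edges E w t \<longrightarrow> w {u, v} < 2 * t \<longrightarrow> ({u, v}, w {u, v}) \<in> F)"

lemma reconstruct_sub_correct:
  assumes U: "U \<in> graph_components V (thr_edges E w t)" and N: "card U \<ge> 2"
    and F: "Some (F, b') \<in> set_spmf (reconstruct_sub U t b)"
  shows "finds_light_edges U t F"
proof -
  obtain A b'' where A_b: "Some (A, b'') \<in> set_spmf
      (estimated_centers U (nat \<lceil>real D * sqrt (real (card U))\<rceil>) t b)"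
    and F: "F = (\<Union>a\<in>A. exhaustive_query (extended_cell U t A a) t)"
  proof -
    obtain r where "r \<in> set_spmf (estimated_centers U (nat \<lceil>real D * sqrt (real (card U))\<rceil>) t b)"
      "Some (F, b') \<in> set_spmf (case r of None \<Rightarrow> return_spmf None | Some (A, b') \<Rightarrow> return_spmf
         (if b' < (\<Sum>a\<in>A. cell_cost U t A a) then None
          else Some (\<Union>a\<in>A. exhaustive_query (extended_cell U t A a) t,
                     b' - (\<Sum>a\<in>A. cell_cost U t A a))))"
      using F unfolding reconstruct_sub_def set_bind_spmf_iff by blast
    with that show ?thesis by (cases r) (auto split: if_splits)
  qed
  have A: "A \<subseteq> U" "A \<noteq> {}" using estimated_centers_correct(2)[OF U N A_b] by auto
  have "({u, v}, w {u, v}) \<in> F"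
    if "u \<in> U" "{u, v} \<in> thr_edges E w t" "w {u, v} < 2 * t" for u v
    using extended_cell_covers[OF U A that] in_exhaustive_query[OF that(2)] by (auto simp: F)
  moreover have "F \<subseteq> weighted_edges E w"
    unfolding F using exhaustive_query_subset by blast
  ultimately show ?thesis by (simp add: finds_light_edges_def)
qed

text \<open>A result stems from some completed run, regardless of earlier aborts. Fixed-point
  induction expresses this without any termination argument.\<close>

lemma reconstruct_correct:
  assumes U: "U \<in> graph_components V (thr_edges E w t)" and N: "card U \<ge> 2"
    and F: "F \<in> set_spmf (reconstruct U t)"
  shows "finds_light_edges U t F"
proof -
  have "\<forall>F\<in>set_spmf (reconstruct U t). finds_light_edges U t F"
  proof (induction rule: reconstruct.fixp_induct)
    case 1
    show ?case by simp
  next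
    case 2
    show ?case by simp
  next
    case (3 f)
    then show ?case
      using reconstruct_sub_correct[OF U N]
      by (fastforce simp: set_bind_spmf_iff split: option.splits)
  qed
  with F show ?thesis by blast
qed

lemma lossless_reconstruct:
  assumes "U \<in> graph_components V (thr_edges E w t)" "card U \<ge> 2"
    and "Some x \<in> set_spmf (reconstruct_sub U t (Q D (card U)))"
  shows "lossless_spmf (reconstruct U t)"
  using reconstruct.simps lossless_reconstruct_sub[OF assms(1,2)] assms(3) by (rule lossless_retry)

section \<open>Processing components and layers\<close>

lemma process_components_correct:
  assumes "set cs \<subseteq> graph_components V (thr_edges E w t)" "m \<ge> 1"
    and "F \<subseteq> weighted_edges E w" "G \<in> set_spmf (process_components m t cs F)"
  shows "F \<subseteq> G \<and> G \<subseteq> weighted_edges E w \<and>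
    (\<forall>c\<in>set cs. \<forall>u v. u \<in> c \<longrightarrow> {u, v} \<in> thr_edges E w t \<longrightarrow>
       w {u, v} < 2 * t \<or> real (card c) \<le> m \<longrightarrow> ({u, v}, w {u, v}) \<in> G)"
  using assms
proof (induction cs arbitrary: F)
  case Nil
  then show ?case by simp
next
  case (Cons c cs)
  let ?p = "if real (card c) \<le> m then return_spmf (exhaustive_query c t) else reconstruct c t"
  obtain F' where F': "F' \<in> set_spmf ?p" "G \<in> set_spmf (process_components m t cs (F \<union> F'))"
    using Cons.prems by (auto simp: set_bind_spmf_iff)
  have c: "c \<in> graph_components V (thr_edges E w t)" using Cons.prems by simp
  have *: "F' \<subseteq> weighted_edges E w \<and> (\<forall>u v. u \<in> c \<longrightarrow> {u, v} \<in> thr_edges E w t \<longrightarrow>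
       w {u, v} < 2 * t \<or> real (card c) \<le> m \<longrightarrow> ({u, v}, w {u, v}) \<in> F')"
  proof (cases "real (card c) \<le> m")
    case True
    then show ?thesis
      using F' exhaustive_query_subset in_exhaustive_query component_neighbour[OF c] by auto
  next
    case False
    \<comment> \<open>As \<open>m \<ge> 1\<close>, reconstruction never meets a singleton, for which
      the iterated logarithm and the degree bounds would give nothing.\<close>
    then have "card c \<ge> 2" using Cons.prems by linarith
    then have "finds_light_edges c t F'"
      using reconstruct_correct[OF c] F' False by auto
    then show ?thesis using False by (auto simp: finds_light_edges_def)
  qed
  then have "F \<union> F' \<subseteq> G \<and> G \<subseteq> weighted_edges E w \<and>
    (\<forall>c\<in>set cs. \<forall>u v. u \<in> c \<longrightarrow> {u, v} \<in> thr_edges E w t \<longrightarrow>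
       w {u, v} < 2 * t \<or> real (card c) \<le> m \<longrightarrow> ({u, v}, w {u, v}) \<in> G)"
    using Cons.prems F' by (intro Cons.IH) auto
  with * show ?case by auto
qed

lemma lossless_process_components:
  assumes "\<And>c. c \<in> set cs \<Longrightarrow> m < real (card c) \<Longrightarrow> lossless_spmf (reconstruct c t)"
  shows "lossless_spmf (process_components m t cs F)"
  using assms by (induction cs arbitrary: F) auto

text \<open>Loop invariant: before layer \<open>i\<close>, \<open>F\<close> holds only true edges
  and all those lighter than \<open>2 ^ i\<close>. Layer \<open>i\<close> supplies the weights in
  \<open>[2 ^ i, 2 ^ (i + 1))\<close>; at \<open>i = k\<close> every edge is covered.\<close>

lemma process_layers_correct:
  assumes vs: "distinct vs" "set vs = V" and m: "m \<ge> 1 \<or> V = {}"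
    and k: "\<And>e. e \<in> E \<Longrightarrow> w e < 2 ^ k"
  shows "\<lbrakk>i \<le> k; F \<subseteq> weighted_edges E w; \<And>e. \<lbrakk>e \<in> E; w e < 2 ^ i\<rbrakk> \<Longrightarrow> (e, w e) \<in> F;
    G \<in> set_spmf (process_layers vs m [i..<k] F)\<rbrakk> \<Longrightarrow> G = weighted_edges E w"
proof (induction "k - i" arbitrary: i F)
  case 0
  then show ?case using k by (auto simp: weighted_edges_def)
next
  case (Suc d)
  let ?t = "2 ^ i :: real"
  define cs where "cs = find_connected_components vs ?t"
  have cs: "set cs = graph_components V (thr_edges E w ?t)"
    using set_find_connected_components[OF vs] by (simp add: cs_def)
  have "i < k" using Suc.hyps by simp
  then have "[i..<k] = i # [Suc i..<k]" by (rule upt_conv_Cons)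
  then obtain F' where F': "F' \<in> set_spmf (process_components m ?t cs F)"
    and G: "G \<in> set_spmf (if \<forall>c\<in>set cs. real (card c) \<le> m then return_spmf F'
             else process_layers vs m [Suc i..<k] F')"
    using Suc.prems(4) by (auto simp: set_bind_spmf_iff Let_def cs_def)
  have "F \<subseteq> F' \<and> F' \<subseteq> weighted_edges E w \<and>
    (\<forall>c\<in>set cs. \<forall>u v. u \<in> c \<longrightarrow> {u, v} \<in> thr_edges E w ?t \<longrightarrow>
       w {u, v} < 2 * ?t \<or> real (card c) \<le> m \<longrightarrow> ({u, v}, w {u, v}) \<in> F')"
  \<comment> \<open>On the empty vertex set \<open>m\<close> may be less than 1, but then there are
    no components to process.\<close>
  proof (cases "V = {}")
    case True
    then have "cs = []" using cs by (simp add: graph_components_def)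
    then show ?thesis using F' Suc.prems by simp
  next
    case False
    then show ?thesis
      using process_components_correct[of cs ?t m F F'] cs m F' Suc.prems by auto
  qed
  then have F'_props: "F \<subseteq> F'" "F' \<subseteq> weighted_edges E w"
    and found: "\<And>c u v. \<lbrakk>c \<in> set cs; u \<in> c; {u, v} \<in> thr_edges E w ?t;
       w {u, v} < 2 * ?t \<or> real (card c) \<le> m\<rbrakk> \<Longrightarrow> ({u, v}, w {u, v}) \<in> F'"
    by blast+
  \<comment> \<open>The first alternative carries the invariant to \<open>Suc i\<close>; the second
    is the exit condition, under which every component was queried exhaustively.\<close>
  have edge: "(e, w e) \<in> F'"
    if e: "e \<in> E" "w e < 2 * ?t \<or> (\<forall>c\<in>set cs. real (card c) \<le> m)" for e
  proof (cases "w e < ?t")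
    case True
    then show ?thesis using Suc.prems e F'_props by blast
  next
    case False
    obtain u v where uv: "e = {u, v}" using e edge_obtain by metis
    then have "u \<in> V" using e edgeD by metis
    then have "{v\<in>V. same_component V (thr_edges E w ?t) u v} \<in> set cs"
      by (auto simp: cs graph_components_def)
    moreover have "e \<in> thr_edges E w ?t" using False e by (simp add: thr_edges_def)
    ultimately show ?thesis
      using found[of "{v\<in>V. same_component V (thr_edges E w ?t) u v}" u v] e \<open>u \<in> V\<close> by (auto simp: uv)
  qed
  show ?case
  proof (cases "\<forall>c\<in>set cs. real (card c) \<le> m")
    case True
    then show ?thesis using G F'_props edge by (auto simp: weighted_edges_def)
  next
    case False
    show ?thesis
    proof (rule Suc.hyps(1))
      show "G \<in> set_spmf (process_layers vs m [Suc i..<k] F')" using G False by simp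
    qed (use Suc.hyps \<open>i < k\<close> F'_props edge in auto)
  qed
qed

lemma lossless_process_layers:
  assumes "distinct vs" "set vs = V"
    and "\<And>j c. \<lbrakk>c \<in> graph_components V (thr_edges E w (2 ^ j)); m < real (card c)\<rbrakk>
      \<Longrightarrow> lossless_spmf (reconstruct c (2 ^ j))"
  shows "lossless_spmf (process_layers vs m js F)"
proof (induction js arbitrary: F)
  case (Cons j js)
  have "lossless_spmf (process_components m (2 ^ j) (find_connected_components vs (2 ^ j)) F)"
    using assms(3) by (intro lossless_process_components)
      (simp add: set_find_connected_components[OF assms(1,2)])
  with Cons show ?case by (simp add: Let_def)
qed simp

text \<open>The given edge makes \<open>E\<close> nonempty, so \<open>Wmax\<close> is a genuine
  maximum and at least 1. Its logarithm is then nonnegative and \<open>nat\<close> does not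
  truncate.\<close>

lemma weight_less_power:
  assumes "e \<in> E"
  shows "w e < 2 ^ nat (\<lfloor>log 2 Wmax\<rfloor> + 1)"
proof -
  have le: "w e \<le> Wmax"
    unfolding Wmax max_weight_def using assms finite_E by (intro Max_ge) auto
  then have W: "Wmax \<ge> 1" using weight_ge1[OF assms] by simp
  then have "log 2 Wmax < real (nat (\<lfloor>log 2 Wmax\<rfloor> + 1))"
    using zero_le_log_cancel_iff[of 2 Wmax] by linarith
  then have "2 powr log 2 Wmax < 2 powr real (nat (\<lfloor>log 2 Wmax\<rfloor> + 1))"
    by (rule powr_less_mono) simp
  then have "Wmax < 2 powr real (nat (\<lfloor>log 2 Wmax\<rfloor> + 1))"
    using W by (simp only: powr_log_cancel)
  with le show ?thesis by (simp add: powr_realpow)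
qed

lemma root_card_ge1: "real (card V) powr (1/4) \<ge> 1 \<or> V = {}"
  using finite_V by (cases "V = {}") (auto simp: card_gt_0_iff Suc_le_eq intro!: ge_one_powr_ge_zero)

lemma lbl_r_correct:
  assumes vs: "distinct vs" "set vs = V" and F: "F \<in> set_spmf (lbl_r vs)"
  shows "F = weighted_edges E w"
proof (rule process_layers_correct[OF vs root_card_ge1 weight_less_power])
  show "F \<in> set_spmf (process_layers vs (real (card V) powr (1/4))
      [0..<nat (\<lfloor>log 2 Wmax\<rfloor> + 1)] {})"
    using F vs distinct_card[of vs] by (simp add: lbl_r_def)
\<comment> \<open>The invariant holds initially for the empty set because no edge is lighter than
  \<open>2 ^ 0\<close>.\<close>
qed (auto dest: weight_ge1)

lemma lossless_lbl_r:
  assumes vs: "distinct vs" "set vs = V"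
    and complete: "\<And>j U. \<lbrakk>U \<in> graph_components V (thr_edges E w (2 ^ j));
        real (card V) powr (1/4) < real (card U)\<rbrakk>
      \<Longrightarrow> \<exists>x. Some x \<in> set_spmf (reconstruct_sub U (2 ^ j) (Q D (card U)))"
  shows "lossless_spmf (lbl_r vs)"
proof -
  have len: "length vs = card V" using vs distinct_card[of vs] by simp
  show ?thesis
    unfolding lbl_r_def len
  proof (rule lossless_process_layers[OF vs])
    fix j c assume c: "c \<in> graph_components V (thr_edges E w (2 ^ j))"
      "real (card V) powr (1/4) < real (card c)"
    then have "V \<noteq> {}" by (auto simp: graph_components_def)
    then have "card c \<ge> 2" using root_card_ge1 c by linarith
    then show "lossless_spmf (reconstruct c (2 ^ j))"
      using lossless_reconstruct c complete[OF c] by blast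
  qed
qed

end

text \<open>The first conjunct says that every possible output is correct. The growth condition
  bounds \<open>Q\<close> only from above and thus admits budgets within which no run completes, so
  the second conjunct asks for a positive chance of completion on each large component before
  asserting almost sure termination.\<close>

theorem theorem1:
  fixes V :: "'a set" and E :: "'a set set" and w :: "'a set \<Rightarrow> real"
    and D :: nat and Wmax :: real
    and K :: real and Q :: "nat \<Rightarrow> nat \<Rightarrow> nat" and vs :: "'a list"
  assumes graph: "weighted_graph V E w"
    and D: "D = max_degree V E"
    and Wmax: "Wmax = max_weight E w"
    and K: "K > 0"
    and Q: "(\<lambda>(d, N). real (Q d N)) \<in> O[top \<times>\<^sub>F sequentially](\<lambda>(d, N).
              real d ^ 3 * real N powr (3/2) * ln (real N) ^ 2 * ln (ln (real N)))"
    and vs: "distinct vs" "set vs = V"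
  shows "(\<forall>F \<in> set_spmf (query_algorithm.lbl_r (q_w E w) (q_d V E w) (q_c V E w) D Wmax K Q vs).
            F = weighted_edges E w) \<and>
         ((\<forall>j. \<forall>U \<in> graph_components V (thr_edges E w (2 ^ j)).
             real (card V) powr (1/4) < real (card U) \<longrightarrow>
             (\<exists>x. Some x \<in> set_spmf (query_algorithm.reconstruct_sub (q_w E w) (q_d V E w) D K
                                       U (2 ^ j) (Q D (card U))))) \<longrightarrow>
          query_algorithm.lbl_r (q_w E w) (q_d V E w) (q_c V E w) D Wmax K Q vs
            = return_spmf (weighted_edges E w))"
proof -
  interpret query_setting V E w D Wmax K Q
    using graph D Wmax K by unfold_locales
  show ?thesis
    using lbl_r_correct[OF vs] lossless_lbl_r[OF vs] unfolding eq_return_spmf_iff by blast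
qed

end
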